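(* Let $U\subseteq\mathbb{R}^N$ be open and let $S$ be an $M\times N$ structure matrix. Every structured function space $\mathcal{F}$ of functions $F:U\to\mathbb{R}^M$ (with respect to $S$) is ACR. In particular, the vector space of all $C^\infty$ functions $F:U\to\mathbb{R}^M$ that respect $S$ is ACR.
   Context: A structure matrix $S$ is an $M\times N$ matrix in which certain entries are allowed to be nonzero and the remaining entries are zero (i.e. a prescribed zero pattern). A $C^1$ function $F=(F_1,\dots,F_M):U\to\mathbb{R}^M$ respects $S$ if $\frac{\partial F_i}{\partial x_j}(x)=0$ for all $x\in U$ whenever $S_{ij}=0$. A real $M\times N$ matrix $A$ respects $S$ if $A_{ij}=0$ whenever $S_{ij}=0$. $\mathcal{L}(S)$ is the set of all functions $x\mapsto Ax$ (on $U$) where $A$ is a real $M\times N$ matrix that respects $S$. A structured function space is a real vector space $\mathcal{F}$ (under pointwise operations) of $C^1$ functions $F:U\to\mathbb{R}^M$ that all respect $S$, such that $\mathcal{L}(S)\subseteq\mathcal{F}$. $DF(x)$ is the $M\times N$ Jacobian matrix. $\operatorname{maxrank}(\mathcal{F})=\max_{F\in\mathcal{F},\,x\in U}\operatorname{rank}(DF(x))$. The vector space $\mathcal{F}$ has almost constant rank (is ACR) if for almost every $F\in\mathcal{F}$ and Lebesgue almost every $x\in U$, $\operatorname{rank}(DF(x))=\operatorname{maxrank}(\mathcal{F})$. "Almost every $F\in\mathcal{F}$": if $\mathcal{F}$ is finite-dimensional, this is with respect to Lebesgue measure on $\mathcal{F}$. If $\mathcal{F}$ is infinite-dimensional, it is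 in the sense of prevalence: a set $G\subseteq\mathcal{F}$ is called measurable if $Z\cap G$ is Lebesgue measurable in $Z$ for every finite-dimensional plane (affine subspace) $Z\subseteq\mathcal{F}$; almost every element of $\mathcal{F}$ is in a measurable set $G$ if there is a finite-dimensional linear subspace $X\subseteq\mathcal{F}$ such that for every $P\in\mathcal{F}$ and Lebesgue almost every $H\in X$ one has $H+P\in G$. A property holds for almost every $F\in\mathcal{F}$ if it holds for all $F$ in some such measurable $G$. *)

theory Defs
  imports "HOL-Analysis.Analysis" "HOL-Library.Function_Algebras"
begin

text \<open>Pointwise scalar multiplication; together with the pointwise group operations of
  \<^theory>\<open>HOL-Library.Function_Algebras\<close> this makes the library notions \<^const>\<open>subspace\<close>,
  \<^const>\<open>span\<close> and \<^const>\<open>independent\<close> available for spaces of functions.\<close>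

instantiation "fun" :: (type, real_vector) real_vector
begin

definition "scaleR c f = (\<lambda>x. c *\<^sub>R f x)"

instance
  by standard (simp_all add: scaleR_fun_def fun_eq_iff scaleR_add_right scaleR_add_left)

end

text \<open>A function \<open>U \<rightarrow> \<real>\<^sup>M\<close> is represented by the total function that agrees with it on \<open>U\<close>
  and is 0 outside \<open>U\<close>. This representation is unique and compatible with the pointwise vector
  space operations. Since \<open>U\<close> is open, derivatives at points of \<open>U\<close> do not
  depend on the values outside \<open>U\<close>.\<close>

definition funs_on :: "('a::zero) set \<Rightarrow> ('a \<Rightarrow> 'b::zero) set" where
  "funs_on U = {F. \<forall>x. x \<notin> U \<longrightarrow> F x = 0}"

text \<open>\<open>k\<close> times continuously differentiable on an open set.\<close>

primrec Ck_on :: "nat \<Rightarrow> 'a set \<Rightarrow> ('a::real_normed_vector \<Rightarrow> 'b::real_normed_vector) \<Rightarrow> bool" where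
  "Ck_on 0 U F \<longleftrightarrow> continuous_on U F"
| "Ck_on (Suc k) U F \<longleftrightarrow>
     (\<forall>x\<in>U. F differentiable (at x)) \<and> (\<forall>v. Ck_on k U (\<lambda>x. frechet_derivative F (at x) v))"

definition smooth_on :: "'a set \<Rightarrow> ('a::real_normed_vector \<Rightarrow> 'b::real_normed_vector) \<Rightarrow> bool" where
  "smooth_on U F \<longleftrightarrow> (\<forall>k. Ck_on k U F)"

text \<open>A structure matrix has type \<^typ>\<open>bool^'n^'m\<close>; the entry \<open>S $ i $ j\<close> is true iff
  the entry \<open>(i, j)\<close> is allowed to be nonzero.\<close>

definition matrix_respects :: "bool^'n^'m \<Rightarrow> real^'n^'m \<Rightarrow> bool" where
  "matrix_respects S A \<longleftrightarrow> (\<forall>i j. \<not> S $ i $ j \<longrightarrow> A $ i $ j = 0)"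

definition fun_respects :: "(real^'n) set \<Rightarrow> bool^'n^'m \<Rightarrow> (real^'n \<Rightarrow> real^'m) \<Rightarrow> bool" where
  "fun_respects U S F \<longleftrightarrow> (\<forall>x\<in>U. matrix_respects S (jacobian F (at x)))"

definition linear_funs :: "(real^'n) set \<Rightarrow> bool^'n^'m \<Rightarrow> (real^'n \<Rightarrow> real^'m) set" where
  "linear_funs U S = {\<lambda>x. if x \<in> U then A *v x else 0 | A. matrix_respects S A}"

definition structured_function_space ::
    "(real^'n) set \<Rightarrow> bool^'n^'m \<Rightarrow> (real^'n \<Rightarrow> real^'m) set \<Rightarrow> bool" where
  "structured_function_space U S V \<longleftrightarrow>
     subspace V \<and> V \<subseteq> funs_on U \<and>
     (\<forall>F\<in>V. Ck_on 1 U F \<and> fun_respects U S F) \<and>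
     linear_funs U S \<subseteq> V"

definition maxrank :: "(real^'n) set \<Rightarrow> (real^'n \<Rightarrow> real^'m) set \<Rightarrow> nat" where
  "maxrank U V = Max {rank (jacobian F (at x)) | F x. F \<in> V \<and> x \<in> U}"

text \<open>For a finite independent set \<open>B\<close>, this is Lebesgue measure on the plane \<open>P + span B\<close>,
  carried over from \<open>\<real>\<^sup>B\<close> along the affine coordinates given by \<open>P\<close> and \<open>B\<close>. Another choice of
  \<open>P\<close> and \<open>B\<close> for the same plane changes the measure only by a positive factor, so the
  measurable sets and the null sets depend only on the plane.\<close>

definition plane_lebesgue :: "'v::real_vector \<Rightarrow> 'v set \<Rightarrow> 'v measure" where
  "plane_lebesgue P B =
     embed_measure (completion (\<Pi>\<^sub>M b\<in>B. lborel)) (\<lambda>c. P + (\<Sum>b\<in>B. c b *\<^sub>R b))"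

definition finite_basis :: "'v::real_vector set \<Rightarrow> 'v set \<Rightarrow> bool" where
  "finite_basis V B \<longleftrightarrow> finite B \<and> independent B \<and> span B = V"

definition planewise_measurable :: "'v::real_vector set \<Rightarrow> 'v set \<Rightarrow> bool" where
  "planewise_measurable V G \<longleftrightarrow> G \<subseteq> V \<and>
     (\<forall>P\<in>V. \<forall>B\<subseteq>V. finite B \<and> independent B \<longrightarrow>
        space (plane_lebesgue P B) \<inter> G \<in> sets (plane_lebesgue P B))"

definition prevalent :: "'v::real_vector set \<Rightarrow> 'v set \<Rightarrow> bool" where
  "prevalent V G \<longleftrightarrow> planewise_measurable V G \<and>
     (\<exists>B\<subseteq>V. finite B \<and> independent B \<and> (\<forall>P\<in>V. AE H in plane_lebesgue 0 B. H + P \<in> G))"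

text \<open>In the finite-dimensional case the choice of the basis is immaterial.\<close>

definition almost_every :: "'v::real_vector set \<Rightarrow> ('v \<Rightarrow> bool) \<Rightarrow> bool" where
  "almost_every V Q \<longleftrightarrow>
     (if \<exists>B. finite_basis V B
      then \<forall>B. finite_basis V B \<longrightarrow> (AE F in plane_lebesgue 0 B. Q F)
      else \<exists>G. prevalent V G \<and> (\<forall>F\<in>G. Q F))"

definition almost_constant_rank :: "(real^'n) set \<Rightarrow> (real^'n \<Rightarrow> real^'m) set \<Rightarrow> bool" where
  "almost_constant_rank U V \<longleftrightarrow>
     almost_every V (\<lambda>F. AE x in lebesgue_on U. rank (jacobian F (at x)) = maxrank U V)"

definition smooth_function_space :: "(real^'n) set \<Rightarrow> bool^'n^'m \<Rightarrow> (real^'n \<Rightarrow> real^'m) set" where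
  "smooth_function_space U S = {F \<in> funs_on U. smooth_on U F \<and> fun_respects U S F}"

end

theory Submission
  imports Defs "HOL-Computational_Algebra.Polynomial"
begin

text \<open>Let \<open>A\<close> have the largest rank \<open>r\<close> among the matrices respecting \<open>S\<close>, and let \<open>L\<close> be the
  linear function given by \<open>A\<close>. Every Jacobian respects \<open>S\<close>, so \<open>r\<close> is the maximal rank, and for
  every matrix \<open>E\<close> the rank of \<open>E + t *\<^sub>R A\<close> drops below \<open>r\<close> for only finitely many \<open>t\<close>. Hence, for every
  \<open>F\<close> and \<open>x\<close>, the Jacobian of \<open>F + t *\<^sub>R L\<close> at \<open>x\<close> has rank \<open>r\<close> for almost every \<open>t\<close>. The line
  spanned by \<open>L\<close> therefore serves as the probe space for prevalence, and Fubini's theorem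
  turns this into a statement about almost every \<open>t\<close> and almost every \<open>x\<close>. In the finite-dimensional
  case, translation invariance of Lebesgue measure turns lines in the direction \<open>L\<close> into full
  measure.\<close>

subsection \<open>Rank of matrices\<close>

lemma rank_add_le:
  fixes A B :: "real^'n^'m"
  shows "rank (A + B) \<le> rank A + rank B"
proof -
  let ?R = "\<lambda>A :: real^'n^'m. range ((*v) A)"
  have sub: "subspace (?R A)" for A :: "real^'n^'m"
    by (intro linear_subspace_image matrix_vector_mul_linear subspace_UNIV)
  have "rank (A + B) \<le> dim {x + y |x y. x \<in> ?R A \<and> y \<in> ?R B}"
    unfolding rank_dim_range
    by (intro dim_subset) (auto simp: matrix_vector_mult_add_rdistrib)
  also have "\<dots> \<le> rank A + rank B"
    using dim_sums_Int[OF sub[of A] sub[of B]] by (simp add: rank_dim_range)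
  finally show ?thesis .
qed

text \<open>The kernel is the orthogonal complement of the row space, whose dimension is the
  rank.\<close>

lemma dim_kernel_plus_rank:
  fixes A :: "real^'n^'m"
  shows "dim {x. A *v x = 0} + rank A = CARD('n)"
proof -
  have "{x. A *v x = 0} = {y \<in> UNIV. \<forall>x\<in>span (rows A). orthogonal x y}"
  proof (intro equalityI subsetI)
    fix y assume "y \<in> {y \<in> UNIV. \<forall>x\<in>span (rows A). orthogonal x y}"
    then have "orthogonal (row i A) y" for i
      by (auto simp: rows_def intro: span_base)
    then have "A *v y = 0"
      by (simp add: vec_eq_iff matrix_vector_mul_component orthogonal_def row_def)
    then show "y \<in> {x. A *v x = 0}"
      by simp
  qed (use orthogonal_nullspace_rowspace[of A] orthogonal_commute in blast)
  then show ?thesis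
    using dim_subspace_orthogonal_to_vectors[of "span (rows A)" "UNIV :: (real^'n) set"]
    by (simp add: row_rank_def)
qed

lemma det_nz_iff_full_rank:
  fixes A :: "real^'n^'n"
  shows "det A \<noteq> 0 \<longleftrightarrow> rank A = CARD('n)"
  by (simp add: full_rank_injective matrix_left_invertible_injective[symmetric]
      invertible_left_inverse[symmetric] invertible_det_nz)

text \<open>Replaces minors of size \<open>k\<close>, which would have to be indexed by varying sets, by determinants of full size. For the converse direction take \<open>D\<close> the transpose of \<open>A\<close> and \<open>C\<close> a Gram-type
  matrix of a basis of the kernel of \<open>A\<close>, which makes \<open>D ** A + C\<close> positive definite.\<close>

lemma rank_ge_iff_det:
  fixes A :: "real^'n^'m"
  shows "k \<le> rank A \<longleftrightarrow> (\<exists>(D :: real^'m^'n) (C :: real^'n^'n). rank C + k \<le> CARD('n) \<and> det (D ** A + C) \<noteq> 0)"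
proof
  assume k: "k \<le> rank A"
  let ?K = "{x. A *v x = 0}"
  have K: "subspace ?K"
    by (auto simp: subspace_def matrix_vector_right_distrib matrix_vector_mult_scaleR)
  obtain B where B: "B \<subseteq> ?K" "independent B" "?K \<subseteq> span B" "card B = dim ?K"
    using basis_exists by blast
  have finB: "finite B"
    using B(2) by (rule finiteI_independent)
  \<comment> \<open>A sum of rank-one maps over a basis \<open>B\<close> of the kernel: its range
    lies in \<open>span B\<close>, so its rank is at most the nullity of \<open>A\<close>, and its
    quadratic form at \<open>x\<close> is a sum of the squares of
    \<open>b \<bullet> x\<close>.\<close>
  define c where "c x = (\<Sum>b\<in>B. (b \<bullet> x) *\<^sub>R b)" for x
  have lin: "linear c"
    unfolding c_def by (intro linearI)
      (simp_all add: inner_right_distrib scaleR_add_left sum.distrib scaleR_sum_right)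
  define C where "C = matrix c"
  have C: "C *v x = c x" for x
    unfolding C_def using lin by (simp add: matrix_works)
  have "range ((*v) C) \<subseteq> span B"
    by (auto simp: C c_def intro!: span_sum span_scale intro: span_base)
  then have "rank C \<le> dim ?K"
    unfolding rank_dim_range B(4)[symmetric] using finB dim_le_card by blast
  then have "rank C + k \<le> CARD('n)"
    using dim_kernel_plus_rank[of A] k by linarith
  moreover have "x = 0" if "(transpose A ** A + C) *v x = 0" for x
  proof -
    \<comment> \<open>The quadratic form is a sum of squares. Its vanishing puts \<open>x\<close>
      into the kernel, hence into \<open>span B\<close>, and also makes \<open>x\<close> orthogonal
      to all of \<open>B\<close>; so \<open>x\<close> is orthogonal to itself.\<close>
    have "0 = x \<bullet> ((transpose A ** A + C) *v x)"
      using that by simp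
    also have "\<dots> = (A *v x) \<bullet> (A *v x) + (\<Sum>b\<in>B. (b \<bullet> x)\<^sup>2)"
      by (simp add: matrix_vector_mult_add_rdistrib C c_def inner_right_distrib inner_sum_right
          matrix_vector_mul_assoc[symmetric] dot_lmul_matrix[symmetric]
          inner_commute power2_eq_square)
    finally have *: "(A *v x) \<bullet> (A *v x) + (\<Sum>b\<in>B. (b \<bullet> x)\<^sup>2) = 0"
      by simp
    have nn: "(A *v x) \<bullet> (A *v x) \<ge> 0" "(\<Sum>b\<in>B. (b \<bullet> x)\<^sup>2) \<ge> 0"
      by (auto intro: sum_nonneg)
    have "(A *v x) \<bullet> (A *v x) = 0"
      using * nn by linarith
    then have "A *v x = 0"
      by simp
    then have "x \<in> span B"
      using B(3) by auto
    moreover have "(\<Sum>b\<in>B. (b \<bullet> x)\<^sup>2) = 0"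
      using * nn by linarith
    then have "\<forall>b\<in>B. orthogonal x b"
      using finB by (simp add: sum_nonneg_eq_0_iff orthogonal_def inner_commute)
    ultimately have "orthogonal x x"
      by (metis orthogonal_to_span)
    then show "x = 0"
      by (simp add: orthogonal_self)
  qed
  then have "inj ((*v) (transpose A ** A + C))"
    by (simp add: linear_injective_0[OF matrix_vector_mul_linear])
  then have "det (transpose A ** A + C) \<noteq> 0"
    by (simp add: det_nz_iff_full_rank full_rank_injective)
  ultimately show "\<exists>(D :: real^'m^'n) (C :: real^'n^'n). rank C + k \<le> CARD('n) \<and> det (D ** A + C) \<noteq> 0"
    by blast
next
  assume "\<exists>(D :: real^'m^'n) (C :: real^'n^'n). rank C + k \<le> CARD('n) \<and> det (D ** A + C) \<noteq> 0"
  then obtain D :: "real^'m^'n" and C :: "real^'n^'n"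
    where DC: "rank C + k \<le> CARD('n)" "det (D ** A + C) \<noteq> 0"
    by blast
  have "CARD('n) = rank (D ** A + C)"
    using DC(2) by (simp add: det_nz_iff_full_rank)
  also have "\<dots> \<le> rank A + rank C"
    using rank_add_le[of "D ** A" C] rank_mul_le_right[of D A] by linarith
  finally show "k \<le> rank A"
    using DC(1) by linarith
qed

lemma continuous_on_det [continuous_intros]:
  fixes f :: "'a::topological_space \<Rightarrow> real^'n^'n"
  assumes "continuous_on S f"
  shows "continuous_on S (\<lambda>x. det (f x))"
  unfolding det_def by (intro continuous_intros assms)

text \<open>Lower semicontinuity of the rank: each certificate \<open>D\<close>, \<open>C\<close>
  contributes an open set of matrices where a determinant is nonzero. This is the source of all
  measurability statements about ranks below.\<close>

lemma open_rank_ge: "open {A :: real^'n^'m. k \<le> rank A}"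
proof -
  have *: "{A :: real^'n^'m. k \<le> rank A} =
      (\<Union>D :: real^'m^'n. \<Union>C \<in> {C :: real^'n^'n. rank C + k \<le> CARD('n)}. {A. det (D ** A + C) \<noteq> 0})"
    by (auto simp: rank_ge_iff_det)
  have "continuous_on UNIV (\<lambda>A :: real^'n^'m. D ** A + C)" for D :: "real^'m^'n" and C
    unfolding matrix_matrix_mult_def by (intro continuous_intros)
  then show ?thesis
    unfolding * by (intro open_UN ballI open_Collect_neq continuous_on_det continuous_on_const)
qed

section \<open>Rank along a matrix pencil\<close>

lemma matrix_mul_scaleR_right:
  fixes A :: "real^'n^'m" and B :: "real^'p^'n"
  shows "A ** (c *\<^sub>R B) = c *\<^sub>R (A ** B)"
  by (simp add: matrix_matrix_mult_def vec_eq_iff sum_distrib_left mult.left_commute)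

lemma matrix_mul_mat_right:
  fixes A :: "real^'n^'m"
  shows "A ** mat c = c *\<^sub>R A"
proof -
  have "mat c = c *\<^sub>R (mat 1 :: real^'n^'n)"
    by (simp add: mat_def vec_eq_iff)
  then show ?thesis
    by (simp add: matrix_mul_scaleR_right)
qed

lemma det_scaleR:
  fixes A :: "real^'n^'n"
  shows "det (c *\<^sub>R A) = c ^ CARD('n) * det A"
  by (simp add: det_def prod.distrib sum_distrib_left algebra_simps)

text \<open>The reversed pencil \<open>G + s *\<^sub>R E\<close> has a polynomial determinant whose
  value at 0 is \<open>det G\<close>, which shows at once that the polynomial is nonzero. Roots t
  other than 0 of the original pencil correspond to roots s = 1/t.\<close>

lemma finite_singular_pencil:
  fixes E G :: "real^'n^'n"
  assumes "det G \<noteq> 0"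
  shows "finite {t. det (E + t *\<^sub>R G) = 0}"
proof -
  define p where "p = (\<Sum>\<sigma> | \<sigma> permutes (UNIV :: 'n set).
      of_int (sign \<sigma>) * (\<Prod>i\<in>UNIV. [:G $ i $ \<sigma> i, E $ i $ \<sigma> i:]))"
  have p: "poly p s = det (G + s *\<^sub>R E)" for s
    by (simp add: p_def det_def poly_sum poly_prod)
  then have "poly p 0 \<noteq> 0"
    using assms by simp
  then have "p \<noteq> 0"
    by auto
  then have "finite (insert 0 (inverse ` {s. poly p s = 0}))"
    by (simp add: poly_roots_finite)
  moreover have "t \<in> inverse ` {s. poly p s = 0}" if "det (E + t *\<^sub>R G) = 0" "t \<noteq> 0" for t
  proof -
    have "G + inverse t *\<^sub>R E = inverse t *\<^sub>R (E + t *\<^sub>R G)"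
      using that by (simp add: scaleR_add_right)
    then have "poly p (inverse t) = inverse t ^ CARD('n) * det (E + t *\<^sub>R G)"
      by (simp add: p det_scaleR)
    then show ?thesis
      using that by (intro image_eqI[of _ _ "inverse t"]) auto
  qed
  then have "{t. det (E + t *\<^sub>R G) = 0} \<subseteq> insert 0 (inverse ` {s. poly p s = 0})"
    by blast
  ultimately show ?thesis
    by (rule finite_subset[rotated])
qed

text \<open>With \<open>D\<close> and \<open>C\<close> certifying \<open>k \<le> rank G\<close>, the pair \<open>D\<close> and \<open>t *\<^sub>R C\<close> certifies
  \<open>k \<le> rank (E + t *\<^sub>R G)\<close> unless the pencil with the invertible direction \<open>D ** G + C\<close>
  is singular at \<open>t\<close>.\<close>

lemma finite_rank_drop_pencil:
  fixes E G :: "real^'n^'m"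
  assumes "k \<le> rank G"
  shows "finite {t. \<not> k \<le> rank (E + t *\<^sub>R G)}"
proof -
  obtain D :: "real^'m^'n" and C :: "real^'n^'n"
    where DC: "rank C + k \<le> CARD('n)" "det (D ** G + C) \<noteq> 0"
    using assms rank_ge_iff_det by blast
  have "k \<le> rank (E + t *\<^sub>R G)" if t: "det (D ** E + t *\<^sub>R (D ** G + C)) \<noteq> 0" for t
  proof -
    \<comment> \<open>Only an inequality, since at t = 0 the rank may drop; a certificate needs no
      more than this bound.\<close>
    have r: "rank (t *\<^sub>R C) \<le> rank C"
      using rank_mul_le_left[of C "mat t"] by (simp add: matrix_mul_mat_right)
    have e: "D ** (E + t *\<^sub>R G) + t *\<^sub>R C = D ** E + t *\<^sub>R (D ** G + C)"
      by (simp add: matrix_add_ldistrib scaleR_add_right matrix_mul_scaleR_right)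
    have "rank (t *\<^sub>R C) + k \<le> CARD('n)"
      using r DC(1) by linarith
    then show ?thesis
      using t e by (subst rank_ge_iff_det) metis
  qed
  then show ?thesis
    by (intro finite_subset[OF _ finite_singular_pencil[OF DC(2), of "D ** E"]]) auto
qed

subsection \<open>Lebesgue measure on planes\<close>

text \<open>It suffices to compare the measures on boxes. The preimage of a box is a box, and the
  claim splits into translation invariance in each coordinate.\<close>

lemma distr_PiM_lborel_translation:
  fixes v :: "'i \<Rightarrow> real"
  assumes "finite B"
  shows "distr (\<Pi>\<^sub>M b\<in>B. lborel) (\<Pi>\<^sub>M b\<in>B. lborel) (\<lambda>c. \<lambda>b\<in>B. c b + v b) = (\<Pi>\<^sub>M b\<in>B. lborel)"
    (is "distr ?M ?M ?f = ?M")
proof -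
  interpret product_sigma_finite "\<lambda>b :: 'i. lborel :: real measure"
    by standard
  interpret finite_product_sigma_finite "\<lambda>b :: 'i. lborel :: real measure" B
    by standard fact
  have f: "?f \<in> measurable ?M ?M"
    by (intro measurable_restrict) measurable
  show ?thesis
  proof (rule PiM_eqI[OF assms])
    fix A :: "'i \<Rightarrow> real set"
    assume A: "\<And>b. b \<in> B \<Longrightarrow> A b \<in> sets lborel"
    have vim: "(\<lambda>x. x + v b) -` A b \<in> sets lborel" if "b \<in> B" for b
      using measurable_sets[of "\<lambda>x. x + v b" lborel lborel "A b"] A[OF that] by simp
    have "?f -` (\<Pi>\<^sub>E b\<in>B. A b) \<inter> space ?M = (\<Pi>\<^sub>E b\<in>B. (\<lambda>x. x + v b) -` A b)"
      by (auto simp: space_PiM PiE_iff extensional_def)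
    then have "emeasure (distr ?M ?M ?f) (\<Pi>\<^sub>E b\<in>B. A b) = (\<Prod>b\<in>B. emeasure lborel ((\<lambda>x. x + v b) -` A b))"
      using A vim assms by (subst emeasure_distr[OF f]) (auto intro!: sets_PiM_I_finite measure_times)
    also have "\<dots> = (\<Prod>b\<in>B. emeasure lborel (A b))"
    proof (rule prod.cong)
      fix b assume "b \<in> B"
      have "emeasure lborel (A b) = emeasure (distr lborel borel ((+) (v b))) (A b)"
        by (simp add: lborel_distr_plus)
      also have "\<dots> = emeasure lborel ((\<lambda>x. x + v b) -` A b)"
        using A[OF \<open>b \<in> B\<close>] by (subst emeasure_distr) (auto simp: vimage_def add.commute)
      finally show "emeasure lborel ((\<lambda>x. x + v b) -` A b) = emeasure lborel (A b)" ..
    qed simp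
    finally show "emeasure (distr ?M ?M ?f) (\<Pi>\<^sub>E b\<in>B. A b) = (\<Prod>b\<in>B. emeasure lborel (A b))" .
  qed simp
qed

text \<open>By Fubini, for almost every t the property holds at the translate of almost every c by t
  times \<open>e\<close>. Translation preserves the measure, so the statement about c does not
  depend on t and is the claim itself.\<close>

lemma AE_PiM_lborel_if_AE_lines:
  fixes e :: "'i \<Rightarrow> real"
  assumes "finite B"
    and P: "{c \<in> space (\<Pi>\<^sub>M b\<in>B. lborel). P c} \<in> sets (\<Pi>\<^sub>M b\<in>B. lborel)"
    and lines: "\<And>c. AE t in lborel. P (\<lambda>b\<in>B. c b + t * e b)"
  shows "AE c in (\<Pi>\<^sub>M b\<in>B. lborel). P c"
proof -
  let ?M = "\<Pi>\<^sub>M b\<in>B. (lborel :: real measure)"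
  interpret product_sigma_finite "\<lambda>b :: 'i. lborel :: real measure"
    by standard
  interpret M: sigma_finite_measure ?M
    by (rule sigma_finite) fact
  interpret pair_sigma_finite ?M "lborel :: real measure"
    by standard
  have "(\<lambda>z. \<lambda>b\<in>B. fst z b + snd z * e b) \<in> measurable (?M \<Otimes>\<^sub>M lborel) ?M"
    by (intro measurable_restrict) measurable
  from measurable_sets[OF this P]
  have meas: "{z \<in> space (?M \<Otimes>\<^sub>M lborel). P (\<lambda>b\<in>B. fst z b + snd z * e b)} \<in> sets (?M \<Otimes>\<^sub>M lborel)"
    by (rule back_subst[of "\<lambda>S. S \<in> sets _"]) (auto simp: space_PiM)
  have "AE c in ?M. AE t in lborel. P (\<lambda>b\<in>B. c b + t * e b)"
    using lines by simp
  then have "AE t in lborel. AE c in ?M. P (\<lambda>b\<in>B. c b + t * e b)"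
    by (subst (asm) AE_commute) (use meas in simp_all)
  moreover have "(AE c in ?M. P (\<lambda>b\<in>B. c b + t * e b)) \<longleftrightarrow> (AE c in ?M. P c)" for t
  proof -
    have f: "(\<lambda>c. \<lambda>b\<in>B. c b + t * e b) \<in> measurable ?M ?M"
      by (intro measurable_restrict) measurable
    show ?thesis
      by (rule AE_distr_iff[OF f P, unfolded distr_PiM_lborel_translation[OF assms(1)], symmetric])
  qed
  ultimately have "AE t in (lborel :: real measure). (AE c in ?M. P c)"
    by simp
  \<comment> \<open>A statement without t that holds for almost every t is true, because
    \<open>lborel\<close> is not the null measure.\<close>
  moreover have "ae_filter (lborel :: real measure) \<noteq> bot"
    by (simp add: ae_filter_eq_bot_iff)
  ultimately show ?thesis
    by (simp add: eventually_const)
qed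

text \<open>The condition says that the section at c of the exceptional set has measure 0, and the
  measure of sections is a measurable function of c.\<close>

lemma sets_Collect_AE:
  assumes "sigma_finite_measure N"
    and R: "{z \<in> space (M \<Otimes>\<^sub>M N). R (fst z) (snd z)} \<in> sets (M \<Otimes>\<^sub>M N)"
  shows "{c \<in> space M. AE x in N. R c x} \<in> sets M"
proof -
  interpret sigma_finite_measure N by fact
  let ?Q = "{z \<in> space (M \<Otimes>\<^sub>M N). \<not> R (fst z) (snd z)}"
  have Q: "?Q \<in> sets (M \<Otimes>\<^sub>M N)"
    by (rule sets.sets_Collect_neg[OF R])
  have "(AE x in N. R c x) \<longleftrightarrow> emeasure N (Pair c -` ?Q) = 0" if "c \<in> space M" for c
    using that by (intro AE_iff_measurable[OF sets_Pair1[OF Q]]) (auto simp: space_pair_measure)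
  then have "{c \<in> space M. AE x in N. R c x} = {c \<in> space M. emeasure N (Pair c -` ?Q) = 0}"
    by blast
  also have "\<dots> \<in> sets M"
    using measurable_emeasure_Pair[OF Q] by measurable
  finally show ?thesis .
qed

lemma sets_Collect_rank_ge:
  fixes J0 :: "'a::euclidean_space \<Rightarrow> real^'n^'m"
  assumes [measurable]: "U \<in> sets borel" "J0 \<in> borel_measurable borel"
    and J: "\<And>b. b \<in> B \<Longrightarrow> J b \<in> borel_measurable borel"
  shows "{z \<in> space ((\<Pi>\<^sub>M b\<in>B. lborel) \<Otimes>\<^sub>M lborel).
      snd z \<in> U \<longrightarrow> k \<le> rank (J0 (snd z) + (\<Sum>b\<in>B. fst z b *\<^sub>R J b (snd z)))}
    \<in> sets ((\<Pi>\<^sub>M b\<in>B. lborel) \<Otimes>\<^sub>M lborel)" (is "?S \<in> sets ?N")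
proof -
  define h where "h z = J0 (snd z) + (\<Sum>b\<in>B. fst z b *\<^sub>R J b (snd z))" for z :: "('b \<Rightarrow> real) \<times> 'a"
  have "(\<lambda>z. fst z b *\<^sub>R J b (snd z)) \<in> borel_measurable ?N" if "b \<in> B" for b
  proof -
    have [measurable]: "J b \<in> borel_measurable borel"
      by (rule J[OF that])
    show ?thesis
      using that by measurable
  qed
  then have "(\<lambda>z. \<Sum>b\<in>B. fst z b *\<^sub>R J b (snd z)) \<in> borel_measurable ?N"
    by (rule borel_measurable_sum)
  moreover have "(\<lambda>z. J0 (snd z)) \<in> borel_measurable ?N"
    by measurable
  ultimately have "h \<in> borel_measurable ?N"
    unfolding h_def by simp
  then have "h -` {A. k \<le> rank A} \<inter> space ?N \<in> sets ?N"
    by (rule measurable_sets) (simp add: open_rank_ge borel_open)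
  moreover have "snd -` (- U) \<inter> space ?N \<in> sets ?N"
    by (rule measurable_sets[OF measurable_snd]) simp
  moreover have "?S = (h -` {A. k \<le> rank A} \<inter> space ?N) \<union> (snd -` (- U) \<inter> space ?N)"
    by (auto simp: h_def)
  ultimately show ?thesis
    by simp
qed

section \<open>Planes in coordinates\<close>

lemma inj_on_plane_coordinates:
  assumes "finite B" "independent B"
  shows "inj_on (\<lambda>c. P + (\<Sum>b\<in>B. c b *\<^sub>R b)) (B \<rightarrow>\<^sub>E UNIV)"
proof (rule inj_onI)
  fix c d :: "'a \<Rightarrow> real"
  assume c: "c \<in> B \<rightarrow>\<^sub>E UNIV" and d: "d \<in> B \<rightarrow>\<^sub>E UNIV"
    and "P + (\<Sum>b\<in>B. c b *\<^sub>R b) = P + (\<Sum>b\<in>B. d b *\<^sub>R b)"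
  then have "(\<Sum>b\<in>B. (c b - d b) *\<^sub>R b) = 0"
    by (simp add: scaleR_diff_left sum_subtractf)
  then have "c b = d b" if "b \<in> B" for b
    using independentD[OF assms(2,1) subset_refl] that by fastforce
  then show "c = d"
    using c d by (intro PiE_ext)
qed

text \<open>The coordinate map is injective, so null sets are transported faithfully, and completing
  the measure does not change what holds almost everywhere.\<close>

lemma AE_plane_lebesgue_iff:
  assumes "finite B" "independent B"
  shows "(AE F in plane_lebesgue P B. Q F) \<longleftrightarrow> (AE c in (\<Pi>\<^sub>M b\<in>B. lborel). Q (P + (\<Sum>b\<in>B. c b *\<^sub>R b)))"
  unfolding plane_lebesgue_def
  using inj_on_plane_coordinates[OF assms]
  by (subst AE_embed_measure') (simp_all add: space_PiM AE_completion_iff)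

text \<open>The part of \<open>G\<close> in the plane is the image of its coordinate set, and a set
  measurable before completion stays measurable after it.\<close>

lemma sets_plane_lebesgueI:
  assumes "finite B" "independent B"
    and "{c \<in> space (\<Pi>\<^sub>M b\<in>B. lborel). P + (\<Sum>b\<in>B. c b *\<^sub>R b) \<in> G} \<in> sets (\<Pi>\<^sub>M b\<in>B. lborel)"
  shows "space (plane_lebesgue P B) \<inter> G \<in> sets (plane_lebesgue P B)"
proof -
  let ?f = "\<lambda>c. P + (\<Sum>b\<in>B. c b *\<^sub>R b)" and ?M = "\<Pi>\<^sub>M b\<in>B. lborel"
  have "space (plane_lebesgue P B) \<inter> G = ?f ` {c \<in> space ?M. ?f c \<in> G}"
    by (auto simp: plane_lebesgue_def space_embed_measure)
  also have "\<dots> \<in> sets (plane_lebesgue P B)"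
    unfolding plane_lebesgue_def using assms(3) by (intro in_sets_embed_measure) simp
  finally show ?thesis .
qed

subsection \<open>Jacobians\<close>

lemma sum_fun_apply: "(\<Sum>b\<in>B. f b) x = (\<Sum>b\<in>B. f b x)"
  for f :: "'i \<Rightarrow> 'a \<Rightarrow> 'b::comm_monoid_add"
  by (induction B rule: infinite_finite_induct) auto

lemma jacobianI:
  fixes F :: "real^'n \<Rightarrow> real^'m"
  assumes "(F has_derivative (\<lambda>h. A *v h)) (at x)"
  shows "jacobian F (at x) = A"
  unfolding jacobian_def using frechet_derivative_at[OF assms, symmetric]
  by (simp add: matrix_of_matrix_vector_mul)

lemma jacobian_add:
  fixes F G :: "real^'n \<Rightarrow> real^'m"
  assumes "F differentiable at x" "G differentiable at x"
  shows "jacobian (F + G) (at x) = jacobian F (at x) + jacobian G (at x)"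
  using has_derivative_add[OF assms[unfolded jacobian_works]]
  by (intro jacobianI) (simp add: plus_fun_def matrix_vector_mult_add_rdistrib)

lemma jacobian_scaleR:
  fixes F :: "real^'n \<Rightarrow> real^'m"
  assumes "F differentiable at x"
  shows "jacobian (c *\<^sub>R F) (at x) = c *\<^sub>R jacobian F (at x)"
  using has_derivative_scaleR_right[OF assms[unfolded jacobian_works], of c]
  by (intro jacobianI) (simp add: scaleR_fun_def scaleR_matrix_vector_assoc)

lemma jacobian_plane:
  fixes P :: "real^'n \<Rightarrow> real^'m"
  assumes "P differentiable at x" "\<And>b. b \<in> B \<Longrightarrow> b differentiable at x"
  shows "jacobian (P + (\<Sum>b\<in>B. c b *\<^sub>R b)) (at x)
    = jacobian P (at x) + (\<Sum>b\<in>B. c b *\<^sub>R jacobian b (at x))"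
proof -
  have "(b has_derivative (\<lambda>h. jacobian b (at x) *v h)) (at x)" if "b \<in> B" for b
    using assms(2)[OF that] by (simp add: jacobian_works)
  then have "((\<lambda>y. P y + (\<Sum>b\<in>B. c b *\<^sub>R b y)) has_derivative
      (\<lambda>h. jacobian P (at x) *v h + (\<Sum>b\<in>B. c b *\<^sub>R (jacobian b (at x) *v h)))) (at x)"
    using assms(1) unfolding jacobian_works
    by (intro has_derivative_add has_derivative_sum has_derivative_scaleR_right)
  moreover have "P + (\<Sum>b\<in>B. c b *\<^sub>R b) = (\<lambda>y. P y + (\<Sum>b\<in>B. c b *\<^sub>R b y))"
    by (simp add: fun_eq_iff sum_fun_apply scaleR_fun_def)
  moreover have "(\<Sum>b\<in>B. c b *\<^sub>R (jacobian b (at x) *v h)) = (\<Sum>b\<in>B. c b *\<^sub>R jacobian b (at x)) *v h" for h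
    by (induction B rule: infinite_finite_induct)
      (simp_all add: matrix_vector_mult_add_rdistrib scaleR_matrix_vector_assoc)
  ultimately show ?thesis
    by (intro jacobianI) (simp add: matrix_vector_mult_add_rdistrib)
qed

lemma continuous_on_jacobian:
  fixes F :: "real^'n \<Rightarrow> real^'m"
  assumes "Ck_on 1 U F"
  shows "continuous_on U (\<lambda>x. jacobian F (at x))"
  using assms unfolding jacobian_def matrix_def
  by (auto intro!: continuous_on_vec_lambda continuous_on_component)

lemma differentiable_Ck_on_1: "Ck_on 1 U F \<Longrightarrow> x \<in> U \<Longrightarrow> F differentiable at x"
  by simp

section \<open>Rank of Jacobians over a plane of functions\<close>

lemma sets_Collect_jacobian_rank_ge:
  fixes P :: "real^'n \<Rightarrow> real^'m"
  assumes U: "open U" and C1: "\<And>F. F \<in> insert P B \<Longrightarrow> Ck_on 1 U F"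
  shows "{z \<in> space ((\<Pi>\<^sub>M b\<in>B. lborel) \<Otimes>\<^sub>M lborel).
      snd z \<in> U \<longrightarrow> k \<le> rank (jacobian (P + (\<Sum>b\<in>B. fst z b *\<^sub>R b)) (at (snd z)))}
    \<in> sets ((\<Pi>\<^sub>M b\<in>B. lborel) \<Otimes>\<^sub>M lborel)"
proof -
  \<comment> \<open>The Jacobian is known to be continuous only on \<open>U\<close>; cut off by the
    indicator it becomes Borel on the whole space.\<close>
  define J where "J F x = indicator U x *\<^sub>R jacobian F (at x)" for F :: "real^'n \<Rightarrow> real^'m" and x
  have J: "J F \<in> borel_measurable borel" if "F \<in> insert P B" for F
    unfolding J_def using U C1[OF that]
    by (intro borel_measurable_continuous_on_indicator continuous_on_jacobian) auto
  have eq: "jacobian (P + (\<Sum>b\<in>B. c b *\<^sub>R b)) (at x) = J P x + (\<Sum>b\<in>B. c b *\<^sub>R J b x)"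
    if "x \<in> U" for c x
    using that C1 by (subst jacobian_plane) (auto simp: J_def intro: differentiable_Ck_on_1)
  have "{z \<in> space ((\<Pi>\<^sub>M b\<in>B. lborel) \<Otimes>\<^sub>M lborel).
      snd z \<in> U \<longrightarrow> k \<le> rank (J P (snd z) + (\<Sum>b\<in>B. fst z b *\<^sub>R J b (snd z)))}
    \<in> sets ((\<Pi>\<^sub>M b\<in>B. lborel) \<Otimes>\<^sub>M lborel)"
    using U J by (intro sets_Collect_rank_ge) auto
  then show ?thesis
    by (simp add: eq cong: conj_cong imp_cong)
qed

text \<open>Trades the completed measure on \<open>U\<close> for \<open>lborel\<close>, so that
  Fubini can be applied to sets in the uncompleted product.\<close>

lemma AE_lebesgue_on_iff:
  "open U \<Longrightarrow> (AE x in lebesgue_on U. Q x) \<longleftrightarrow> (AE x in lborel. x \<in> U \<longrightarrow> Q x)"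
  for U :: "'a::euclidean_space set"
  by (subst AE_restrict_space_iff) (auto simp: AE_completion_iff)

lemma sets_Collect_AE_jacobian_rank_ge:
  fixes P :: "real^'n \<Rightarrow> real^'m"
  assumes "open U" "\<And>F. F \<in> insert P B \<Longrightarrow> Ck_on 1 U F"
  shows "{c \<in> space (\<Pi>\<^sub>M b\<in>B. lborel).
      AE x in lebesgue_on U. k \<le> rank (jacobian (P + (\<Sum>b\<in>B. c b *\<^sub>R b)) (at x))}
    \<in> sets (\<Pi>\<^sub>M b\<in>B. lborel)"
  unfolding AE_lebesgue_on_iff[OF assms(1)]
  using sets_Collect_jacobian_rank_ge[OF assms] sigma_finite_lborel by (rule sets_Collect_AE[rotated])

text \<open>Fix x first. Moving the coefficients along the coordinates \<open>e\<close> of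
  \<open>L\<close> adds multiples of the Jacobian of \<open>L\<close>, so on each such line the rank
  is too small only finitely often. Hence almost every c is good for this x, and Fubini exchanges c
  and x.\<close>

lemma AE_AE_jacobian_rank_ge:
  fixes P L :: "real^'n \<Rightarrow> real^'m"
  assumes U: "open U" and C1: "\<And>F. F \<in> insert P B \<Longrightarrow> Ck_on 1 U F"
    and "finite B" "L \<in> span B"
    and L: "\<And>x. x \<in> U \<Longrightarrow> k \<le> rank (jacobian L (at x))"
  shows "AE c in (\<Pi>\<^sub>M b\<in>B. lborel).
    AE x in lebesgue_on U. k \<le> rank (jacobian (P + (\<Sum>b\<in>B. c b *\<^sub>R b)) (at x))"
proof -
  let ?M = "\<Pi>\<^sub>M b\<in>B. (lborel :: real measure)"
  let ?R = "\<lambda>c x. x \<in> U \<longrightarrow> k \<le> rank (jacobian (P + (\<Sum>b\<in>B. c b *\<^sub>R b)) (at x))"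
  interpret product_sigma_finite "\<lambda>b :: real^'n \<Rightarrow> real^'m. lborel :: real measure"
    by standard
  interpret M: sigma_finite_measure ?M
    by (rule sigma_finite) fact
  interpret pair_sigma_finite ?M "lborel :: (real^'n) measure"
    by standard
  have meas: "{z \<in> space (?M \<Otimes>\<^sub>M lborel). ?R (fst z) (snd z)} \<in> sets (?M \<Otimes>\<^sub>M lborel)"
    by (rule sets_Collect_jacobian_rank_ge[OF U C1])
  obtain e where e: "L = (\<Sum>b\<in>B. e b *\<^sub>R b)"
    using assms(3,4) by (auto simp: span_finite)
  have "AE c in ?M. ?R c x" for x
  proof (rule AE_PiM_lborel_if_AE_lines[OF \<open>finite B\<close>])
    have "(\<lambda>c. (c, x)) \<in> measurable ?M (?M \<Otimes>\<^sub>M lborel)"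
      by measurable
    from measurable_sets[OF this meas]
    show "{c \<in> space ?M. ?R c x} \<in> sets ?M"
      by (rule back_subst[of "\<lambda>S. S \<in> sets _"]) (auto simp: space_pair_measure)
  next
    fix c
    have "jacobian (P + (\<Sum>b\<in>B. (\<lambda>b\<in>B. c b + t * e b) b *\<^sub>R b)) (at x)
        = jacobian (P + (\<Sum>b\<in>B. c b *\<^sub>R b)) (at x) + t *\<^sub>R jacobian L (at x)" if "x \<in> U" for t
    proof -
      have diff: "F differentiable at x" if "F \<in> insert P B" for F
        using C1[OF that] \<open>x \<in> U\<close> by (rule differentiable_Ck_on_1)
      \<comment> \<open>The expansion of the Jacobian of \<open>L\<close> is
        \<open>jacobian_plane\<close> with base point the zero function.\<close>
      have zero: "((0 :: real^'n \<Rightarrow> real^'m) has_derivative (\<lambda>h. 0 *v h)) (at x)"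
        by (simp add: zero_fun_def)
      have "jacobian L (at x) = (\<Sum>b\<in>B. e b *\<^sub>R jacobian b (at x))"
        using jacobian_plane[OF differentiableI[OF zero], of B e] diff jacobianI[OF zero]
        by (simp add: e)
      then show ?thesis
        using diff jacobian_plane[of P x B c] jacobian_plane[of P x B "\<lambda>b\<in>B. c b + t * e b"]
        by (simp add: scaleR_add_left sum.distrib scaleR_sum_right add.assoc)
    qed
    then have "{t. \<not> ?R (\<lambda>b\<in>B. c b + t * e b) x} \<subseteq>
        {t. x \<in> U \<and> \<not> k \<le> rank (jacobian (P + (\<Sum>b\<in>B. c b *\<^sub>R b)) (at x) + t *\<^sub>R jacobian L (at x))}"
      by auto
    also have "finite \<dots>"
      using finite_rank_drop_pencil[OF L] by (cases "x \<in> U") auto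
    finally (finite_subset) have "{t. \<not> ?R (\<lambda>b\<in>B. c b + t * e b) x} \<in> null_sets lborel"
      by (rule finite_imp_null_set_lborel)
    from AE_not_in[OF this] show "AE t in lborel. ?R (\<lambda>b\<in>B. c b + t * e b) x"
      by simp
  qed
  then have "AE x in lborel. AE c in ?M. ?R c x"
    by simp
  then have "AE c in ?M. AE x in lborel. ?R c x"
    by (subst AE_commute) (use meas in simp_all)
  then show ?thesis
    unfolding AE_lebesgue_on_iff[OF U] .
qed

subsection \<open>Structured function spaces\<close>

text \<open>Since \<open>U\<close> is open, derivatives on \<open>U\<close> also agree, which
  carries the induction. It allows \<open>frechet_derivative\<close> to be replaced by a formula
  valid only on \<open>U\<close>.\<close>

lemma Ck_on_cong:
  assumes "open U" "Ck_on k U f" "\<And>x. x \<in> U \<Longrightarrow> f x = g x"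
  shows "Ck_on k U g"
  using assms(2,3)
proof (induction k arbitrary: f g)
  case 0
  then show ?case
    by (simp cong: continuous_on_cong)
next
  case (Suc k)
  have "g differentiable at x" if x: "x \<in> U" for x
  proof -
    obtain D where "(f has_derivative D) (at x)"
      using Suc.prems(1) x by (auto simp: differentiable_def)
    then have "(g has_derivative D) (at x)"
      by (rule has_derivative_transform_within_open[OF _ \<open>open U\<close> x Suc.prems(2)])
    then show ?thesis
      by (rule differentiableI)
  qed
  moreover have "frechet_derivative f (at x) = frechet_derivative g (at x)" if "x \<in> U" for x
    using Suc.prems that by (intro frechet_derivative_transform_within_open[OF _ \<open>open U\<close>]) auto
  then have "Ck_on k U (\<lambda>x. frechet_derivative g (at x) v)" for v
    using Suc.prems(1) by (auto intro: Suc.IH[of "\<lambda>x. frechet_derivative f (at x) v"])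
  ultimately show ?case
    by simp
qed

lemma Ck_on_add:
  assumes "open U" "Ck_on k U f" "Ck_on k U g"
  shows "Ck_on k U (\<lambda>x. f x + g x)"
  using assms(2,3)
proof (induction k arbitrary: f g)
  case 0
  then show ?case
    by (simp add: continuous_on_add)
next
  case (Suc k)
  have D: "((\<lambda>x. f x + g x) has_derivative
      (\<lambda>v. frechet_derivative f (at x) v + frechet_derivative g (at x) v)) (at x)" if "x \<in> U" for x
    using Suc.prems that by (intro has_derivative_add) (auto simp: frechet_derivative_works[symmetric])
  have "Ck_on k U (\<lambda>x. frechet_derivative (\<lambda>x. f x + g x) (at x) v)" for v
  proof (rule Ck_on_cong[OF \<open>open U\<close>])
    show "Ck_on k U (\<lambda>x. frechet_derivative f (at x) v + frechet_derivative g (at x) v)"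
      using Suc.prems by (simp add: Suc.IH)
  qed (simp add: frechet_derivative_at[OF D, symmetric])
  then show ?case
    using differentiableI[OF D] by simp
qed

lemma Ck_on_scaleR:
  assumes "open U" "Ck_on k U f"
  shows "Ck_on k U (\<lambda>x. c *\<^sub>R f x)"
  using assms(2)
proof (induction k arbitrary: f)
  case 0
  then show ?case
    by (simp add: continuous_on_scaleR)
next
  case (Suc k)
  have D: "((\<lambda>x. c *\<^sub>R f x) has_derivative (\<lambda>v. c *\<^sub>R frechet_derivative f (at x) v)) (at x)"
    if "x \<in> U" for x
    using Suc.prems that by (intro has_derivative_scaleR_right) (auto simp: frechet_derivative_works[symmetric])
  have "Ck_on k U (\<lambda>x. frechet_derivative (\<lambda>x. c *\<^sub>R f x) (at x) v)" for v
  proof (rule Ck_on_cong[OF \<open>open U\<close>])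
    show "Ck_on k U (\<lambda>x. c *\<^sub>R frechet_derivative f (at x) v)"
      using Suc.prems by (simp add: Suc.IH)
  qed (simp add: frechet_derivative_at[OF D, symmetric])
  then show ?case
    using differentiableI[OF D] by simp
qed

lemma Ck_on_const: "Ck_on k U (\<lambda>x. a)"
  by (induction k arbitrary: a) simp_all

lemma Ck_on_linear:
  assumes "bounded_linear f"
  shows "Ck_on k U f"
proof (cases k)
  case 0
  then show ?thesis
    using assms by (simp add: linear_continuous_on)
next
  case (Suc l)
  have "frechet_derivative f (at x) = f" for x
    using bounded_linear_imp_has_derivative[OF assms] by (rule frechet_derivative_at[symmetric])
  then show ?thesis
    using Suc assms by (simp add: Ck_on_const bounded_linear_imp_differentiable)
qed

lemma jacobian_linear_fun:
  fixes A :: "real^'n^'m"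
  assumes "open U" "x \<in> U"
  shows "jacobian (\<lambda>x. if x \<in> U then A *v x else 0) (at x) = A"
proof (rule jacobianI)
  have "((*v) A has_derivative (*v) A) (at x)"
    by (intro bounded_linear_imp_has_derivative matrix_vector_mul_bounded_linear)
  then show "((\<lambda>x. if x \<in> U then A *v x else 0) has_derivative (*v) A) (at x)"
    by (rule has_derivative_transform_within_open[OF _ assms]) simp
qed

lemma structured_function_space_smooth:
  fixes U :: "(real^'n) set" and S :: "bool^'n^'m"
  assumes "open U"
  shows "structured_function_space U S (smooth_function_space U S)"
proof -
  have C1: "Ck_on 1 U F" if "smooth_on U F" for F :: "real^'n \<Rightarrow> real^'m"
    using that unfolding smooth_on_def by blast
  note diff = differentiable_Ck_on_1[OF C1]
  have lin: "(\<lambda>x. if x \<in> U then A *v x else 0) \<in> smooth_function_space U S" if "matrix_respects S A" for A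
  proof -
    have "Ck_on k U ((*v) A)" for k
      by (intro Ck_on_linear matrix_vector_mul_bounded_linear)
    then have "Ck_on k U (\<lambda>x. if x \<in> U then A *v x else 0)" for k
      by (rule Ck_on_cong[OF assms]) simp
    then show ?thesis
      using that by (simp add: smooth_function_space_def funs_on_def smooth_on_def fun_respects_def
          jacobian_linear_fun[OF assms])
  qed
  have "subspace (smooth_function_space U S)"
    unfolding subspace_def
  proof (intro conjI ballI allI)
    show "0 \<in> smooth_function_space U S"
      using lin[of 0] by (simp add: matrix_respects_def zero_fun_def cong: if_cong)
  next
    fix F G assume F: "F \<in> smooth_function_space U S" and G: "G \<in> smooth_function_space U S"
    have "jacobian (F + G) (at x) = jacobian F (at x) + jacobian G (at x)" if "x \<in> U" for x
      using F G that by (intro jacobian_add diff) (simp_all add: smooth_function_space_def)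
    moreover have "smooth_on U (F + G)"
      using F G unfolding smooth_on_def smooth_function_space_def plus_fun_def
      by (simp add: Ck_on_add[OF assms])
    ultimately show "F + G \<in> smooth_function_space U S"
      using F G by (simp add: smooth_function_space_def funs_on_def fun_respects_def matrix_respects_def)
  next
    fix c F assume F: "F \<in> smooth_function_space U S"
    have "jacobian (c *\<^sub>R F) (at x) = c *\<^sub>R jacobian F (at x)" if "x \<in> U" for x
      using F that by (intro jacobian_scaleR diff) (simp_all add: smooth_function_space_def)
    moreover have "smooth_on U (c *\<^sub>R F)"
      using F unfolding smooth_on_def smooth_function_space_def scaleR_fun_def
      by (simp add: Ck_on_scaleR[OF assms])
    moreover have "c *\<^sub>R F \<in> funs_on U"
      using F by (simp add: smooth_function_space_def funs_on_def scaleR_fun_def)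
    ultimately show "c *\<^sub>R F \<in> smooth_function_space U S"
      using F by (simp add: smooth_function_space_def fun_respects_def matrix_respects_def)
  qed
  then show ?thesis
    unfolding structured_function_space_def
    using lin C1 by (auto simp: linear_funs_def smooth_function_space_def)
qed

section \<open>Maximal rank and almost constant rank\<close>

text \<open>Every Jacobian respects \<open>S\<close>, which gives the upper bound; the linear
  function of \<open>A\<close> attains it at the given point x.\<close>

lemma maxrank_eq:
  fixes S :: "bool^'n^'m"
  assumes "open U" "structured_function_space U S V" "x \<in> U"
    and A: "matrix_respects S A" "\<And>B. matrix_respects S B \<Longrightarrow> rank B \<le> rank A"
  shows "maxrank U V = rank A"
  unfolding maxrank_def
proof (rule Max_eqI)
  have le: "k \<le> rank A" if "k \<in> {rank (jacobian F (at x)) |F x. F \<in> V \<and> x \<in> U}" for k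
    using that assms(2) A(2) unfolding structured_function_space_def fun_respects_def by blast
  then show "finite {rank (jacobian F (at x)) |F x. F \<in> V \<and> x \<in> U}"
    by (intro finite_subset[OF _ finite_atMost[of "rank A"]]) blast
  show "k \<le> rank A" if "k \<in> {rank (jacobian F (at x)) |F x. F \<in> V \<and> x \<in> U}" for k
    using that by (rule le)
  have "(\<lambda>x. if x \<in> U then A *v x else 0) \<in> V"
    using assms(2) A(1) unfolding structured_function_space_def linear_funs_def by blast
  then show "rank A \<in> {rank (jacobian F (at x)) |F x. F \<in> V \<and> x \<in> U}"
    using jacobian_linear_fun[OF assms(1,3), of A] assms(3) by (intro CollectI exI conjI) auto
qed

text \<open>Covers both readings of "almost every". A basis of a finite-dimensional \<open>V\<close>
  spans \<open>L\<close>, so the second condition applies with P = 0. Otherwise the functions in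
  \<open>V\<close> satisfying \<open>Q\<close> form the prevalent set, with probe space spanned by
  \<open>L\<close>.\<close>

lemma almost_everyI:
  assumes V: "subspace V" and "L \<in> V"
    and Q: "\<And>P B. P \<in> V \<Longrightarrow> B \<subseteq> V \<Longrightarrow> finite B \<Longrightarrow>
      {c \<in> space (\<Pi>\<^sub>M b\<in>B. lborel). Q (P + (\<Sum>b\<in>B. c b *\<^sub>R b))} \<in> sets (\<Pi>\<^sub>M b\<in>B. lborel)"
      "\<And>P B. P \<in> V \<Longrightarrow> B \<subseteq> V \<Longrightarrow> finite B \<Longrightarrow> L \<in> span B \<Longrightarrow>
      AE c in (\<Pi>\<^sub>M b\<in>B. lborel). Q (P + (\<Sum>b\<in>B. c b *\<^sub>R b))"
  shows "almost_every V Q"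
proof (cases "\<exists>B. finite_basis V B")
  case True
  have "AE F in plane_lebesgue 0 B. Q F" if "finite_basis V B" for B
    using that Q(2)[of 0 B] \<open>L \<in> V\<close> subspace_0[OF V]
    by (auto simp: finite_basis_def AE_plane_lebesgue_iff span_superset)
  with True show ?thesis
    unfolding almost_every_def by simp
next
  case False
  define G where "G = {F \<in> V. Q F}"
  have plane: "P + (\<Sum>b\<in>B. c b *\<^sub>R b) \<in> V" if "P \<in> V" "B \<subseteq> V" for P B c
    using V that by (intro subspace_add subspace_sum subspace_scale) auto
  have "planewise_measurable V G"
    unfolding planewise_measurable_def using Q(1)
    by (auto simp: G_def plane intro!: sets_plane_lebesgueI)
  \<comment> \<open>If \<open>L\<close> is zero, as when \<open>S\<close> permits no nonzero entry,
    the set {0} would be dependent, and the empty basis is taken instead.\<close>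
  moreover define B where "B = (if L = 0 then {} else {L})"
  have B: "B \<subseteq> V" "finite B" "independent B" "L \<in> span B"
    using \<open>L \<in> V\<close> by (auto simp: B_def span_base independent_empty)
  have "AE H in plane_lebesgue 0 B. H + P \<in> G" if "P \<in> V" for P
    using Q(2)[OF that B(1,2,4)] plane[OF that B(1)] B
    by (simp add: AE_plane_lebesgue_iff G_def add.commute)
  ultimately have "prevalent V G"
    unfolding prevalent_def using B by blast
  with False show ?thesis
    unfolding almost_every_def G_def by auto
qed

lemma almost_constant_rank_structured:
  fixes U :: "(real^'n) set" and S :: "bool^'n^'m"
  assumes U: "open U" and V: "structured_function_space U S V"
  shows "almost_constant_rank U V"
proof -
  \<comment> \<open>Ranks are bounded by the number of columns and the zero matrix respects
    \<open>S\<close>, so a largest rank is attained.\<close>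
  have "\<exists>A. matrix_respects S A \<and> (\<forall>B. matrix_respects S B \<longrightarrow> rank B \<le> rank A)"
  proof (rule ex_has_greatest_nat)
    show "matrix_respects S 0"
      by (simp add: matrix_respects_def)
    show "\<forall>B. matrix_respects S B \<longrightarrow> rank B < Suc (CARD('n))"
      using rank_bound by (metis less_Suc_eq_le min.boundedE)
  qed
  then obtain A where A: "matrix_respects S A" "\<And>B. matrix_respects S B \<Longrightarrow> rank B \<le> rank A"
    by blast
  let ?L = "\<lambda>x. if x \<in> U then A *v x else 0"
  have sub: "subspace V" and L: "?L \<in> V" and C1: "\<And>F. F \<in> V \<Longrightarrow> Ck_on 1 U F"
    using V A(1) unfolding structured_function_space_def linear_funs_def by blast+
  \<comment> \<open>No Jacobian exceeds \<open>rank A\<close>, so equality becomes the lower bound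
    treated above. For empty \<open>U\<close> the value of \<open>maxrank\<close> is the
    \<open>Max\<close> of an empty set, but \<open>AE_cong\<close> only asks about points of
    \<open>U\<close>.\<close>
  have iff: "(AE x in lebesgue_on U. rank (jacobian F (at x)) = maxrank U V) \<longleftrightarrow>
      (AE x in lebesgue_on U. rank A \<le> rank (jacobian F (at x)))" if "F \<in> V" for F
  proof (rule AE_cong)
    fix x assume "x \<in> space (lebesgue_on U)"
    then have "x \<in> U"
      by simp
    moreover have "matrix_respects S (jacobian F (at x))"
      using V that \<open>x \<in> U\<close> unfolding structured_function_space_def fun_respects_def by blast
    ultimately show "rank (jacobian F (at x)) = maxrank U V \<longleftrightarrow> rank A \<le> rank (jacobian F (at x))"
      using A(2) maxrank_eq[OF U V \<open>x \<in> U\<close> A] by (metis order_antisym order_refl)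
  qed
  have plane: "P + (\<Sum>b\<in>B. c b *\<^sub>R b) \<in> V" if "P \<in> V" "B \<subseteq> V" for P B c
    using sub that by (intro subspace_add subspace_sum subspace_scale) auto
  show ?thesis
    unfolding almost_constant_rank_def
  proof (rule almost_everyI[OF sub L])
    fix P B assume PB: "P \<in> V" "B \<subseteq> V" "finite B"
    then have PB_C1: "Ck_on 1 U F" if "F \<in> insert P B" for F
      using that C1 by blast
    show "{c \<in> space (\<Pi>\<^sub>M b\<in>B. lborel). AE x in lebesgue_on U.
        rank (jacobian (P + (\<Sum>b\<in>B. c b *\<^sub>R b)) (at x)) = maxrank U V} \<in> sets (\<Pi>\<^sub>M b\<in>B. lborel)"
      unfolding iff[OF plane[OF PB(1,2)]]
      by (rule sets_Collect_AE_jacobian_rank_ge[OF U PB_C1])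
    assume LB: "?L \<in> span B"
    show "AE c in (\<Pi>\<^sub>M b\<in>B. lborel). AE x in lebesgue_on U.
        rank (jacobian (P + (\<Sum>b\<in>B. c b *\<^sub>R b)) (at x)) = maxrank U V"
      unfolding iff[OF plane[OF PB(1,2)]]
      by (rule AE_AE_jacobian_rank_ge[OF U PB_C1 PB(3) LB]) (simp_all add: jacobian_linear_fun[OF U])
  qed
qed

theorem proposition4:
  fixes U :: "(real^'n) set" and S :: "bool^'n^'m"
  assumes "open U"
  shows "(\<forall>V :: (real^'n \<Rightarrow> real^'m) set.
            structured_function_space U S V \<longrightarrow> almost_constant_rank U V)
         \<and> almost_constant_rank U (smooth_function_space U S)"
  using almost_constant_rank_structured[OF assms] structured_function_space_smooth[OF assms] by blast

end
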